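(* In the market described in the context, let $\bar\epsilon\ge0$ and let $p$ be any payment rule that charges at most $\bar\epsilon$ less than the VCG mechanism under the same bid profile, i.e. $p_a(\mathcal{B})\ge p_a^{\mathrm{VCG}}(\mathcal{B})-\bar\epsilon$ for every area $a\in A$ and every admissible bid profile $\mathcal{B}$. Then for every area $a$, every admissible profile $\mathcal{B}_{-a}$ of the other areas and every (nontruthful) admissible bid $\mathcal{B}_a$ of area $a$, the additional utility from the unilateral deviation from the true valuation satisfies $$u_a(\mathcal{B}_a\cup\mathcal{B}_{-a})-u_a(\mathcal{V}_a\cup\mathcal{B}_{-a})\ \le\ \bar\epsilon+u_a^{\mathrm{VCG}}(\mathcal{V}_a\cup\mathcal{B}_{-a})-u_a(\mathcal{V}_a\cup\mathcal{B}_{-a}),$$ where $u_a^{\mathrm{VCG}}(\mathcal{V}_a\cup\mathcal{B}_{-a})=V(\mathcal{V}_a\cup\mathcal{B}_{-a})-V(\mathcal{B}_{-a})$ is the VCG utility under the true valuation, and $u_a$ denotes the true utility under $p$.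
   Context: Market. $(A,E)$ is a finite connected simple undirected graph; $A$ is the set of areas, $E$ the set of links. For $S\subseteq A$, $E_S$ is the set of links with exactly one endpoint in $S$ (write $E_a=E_{\{a\}}$), and $E^S$ is the set of links with both endpoints in $S$. An allocation is $\chi\in[0,1]^E$; for $F\subseteq E$, $\chi_F=\{\chi_e\}_{e\in F}$. A default allocation $\chi'\in[0,1]^E$ and a set $\mathbb{S}\subseteq[0,1]^E$ with $\chi'\in\mathbb{S}$ are fixed. Each area $a$ has a true valuation $v_a:\mathbb{X}_a\to\mathbb{R}$, where $\chi'_{E_a}\in\mathbb{X}_a\subseteq[0,1]^{E_a}$ and $v_a(\chi'_{E_a})=0$; by convention $v_a=-\infty$ outside $\mathbb{X}_a$. Each area submits a (possibly nontruthful) bid $b_a:\hat{\mathbb{X}}_a\to\mathbb{R}$ with $\chi'_{E_a}\in\hat{\mathbb{X}}_a\subseteq[0,1]^{E_a}$ and $b_a(\chi'_{E_a})=0$. No continuity, convexity, monotonicity or sign conditions are imposed. A bid profile is $\mathcal{B}=\{b_a\}_{a\in A}$, the true profile is $\mathcal{V}=\{v_a\}_{a\in A}$; for $S\subseteq A$, $\mathcal{B}_S=\{b_a\}_{a\in S}$, $\mathcal{B}_a=\{b_a\}$, $\mathcal{V}_a=\{v_a\}$, $\mathcal{B}_{-a}=\{b_j\}_{j\in A\setminus\{a\}}$. Each area has a set of admissible bids containing $v_a$, a profile is admissible if every component is, and all maxima below are assumed attained for admissible profiles. Allocation rule: $\chi^*(\mathcal{B})$ is a maximizer (selected by a fixed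 tie-breaking rule) of $$V(\mathcal{B})=\max_{\chi\in\mathbb{S}}\sum_{a\in A}b_a(\chi_{E_a})\ \text{ s.t. } \chi_{E_a}\in\hat{\mathbb{X}}_a\ \forall a\in A.$$ For $S\subseteq A$, $$V(\mathcal{B}_S)=\max_{\chi\in\mathbb{S}}\sum_{a\in S}b_a(\chi_{E_a})\ \text{ s.t. } \chi_{E_a}\in\hat{\mathbb{X}}_a\ \forall a\in S,\quad \chi_e=\chi'_e\ \forall e\in E\setminus E^S,$$ and $V(\mathcal{B}_{-a})$ is this value for $S=A\setminus\{a\}$. (When an area bids truthfully, its bid is $v_a$ with domain $\mathbb{X}_a$.) A payment rule assigns $p_a(\mathcal{B})\in\mathbb{R}$ to each area. True utilities: $u_a(\mathcal{B})=v_a(\chi^*_{E_a}(\mathcal{B}))-p_a(\mathcal{B})$. The VCG payment is $p_a^{\mathrm{VCG}}(\mathcal{B})=b_a(\chi^*_{E_a}(\mathcal{B}))-(V(\mathcal{B})-V(\mathcal{B}_{-a}))$. *)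

theory Defs
  imports "HOL-Library.FuncSet" "HOL-Library.Extended_Real"
begin

text \<open>Links are two-element sets of areas. An element of \<open>[0,1]\<^sup>F\<close> is a function
  that is \<open>undefined\<close> outside \<open>F\<close>, so \<open>\<chi>\<^sub>F\<close> is \<open>restrict \<chi> F\<close>. A function with domain \<open>X \<subseteq> [0,1]\<^sup>F\<close>
  is a partial map \<open>b\<close> with \<open>dom b = X\<close>.\<close>

type_synonym 'a alloc = "'a set \<Rightarrow> real"
type_synonym 'a bid = "'a alloc \<rightharpoonup> real"
type_synonym 'a profile = "'a \<Rightarrow> 'a bid"

definition simple_graph :: "'a set \<Rightarrow> 'a set set \<Rightarrow> bool" where
  "simple_graph A E \<longleftrightarrow> finite A \<and> (\<forall>e\<in>E. e \<subseteq> A \<and> card e = 2)"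

definition connected_graph :: "'a set \<Rightarrow> 'a set set \<Rightarrow> bool" where
  "connected_graph A E \<longleftrightarrow> (\<forall>x\<in>A. \<forall>y\<in>A. (x, y) \<in> {(u, w). {u, w} \<in> E}\<^sup>*)"

definition cut_links :: "'a set set \<Rightarrow> 'a set \<Rightarrow> 'a set set" where
  "cut_links E S = {e \<in> E. card (e \<inter> S) = 1}"

definition inner_links :: "'a set set \<Rightarrow> 'a set \<Rightarrow> 'a set set" where
  "inner_links E S = {e \<in> E. e \<subseteq> S}"

definition allocations :: "'a set set \<Rightarrow> 'a alloc set" where
  "allocations F = (\<Pi>\<^sub>E e\<in>F. {0..1})"

definition area_alloc :: "'a set set \<Rightarrow> 'a alloc \<Rightarrow> 'a \<Rightarrow> 'a alloc" where
  "area_alloc E \<chi> a = restrict \<chi> (cut_links E {a})"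

definition valid_bid :: "'a set set \<Rightarrow> 'a alloc \<Rightarrow> 'a \<Rightarrow> 'a bid \<Rightarrow> bool" where
  "valid_bid E \<chi>\<^sub>0 a b \<longleftrightarrow>
     dom b \<subseteq> allocations (cut_links E {a}) \<and> b (area_alloc E \<chi>\<^sub>0 a) = Some 0"

definition admissible_profiles :: "'a set \<Rightarrow> ('a \<Rightarrow> 'a bid set) \<Rightarrow> 'a profile set" where
  "admissible_profiles S Adm = (\<Pi>\<^sub>E a\<in>S. Adm a)"

text \<open>The market restricted to the areas in \<open>S\<close>. If \<open>S\<close> consists of all areas then
  \<open>E - inner_links E S\<close> is empty, so the last constraint disappears.\<close>

definition feasible ::
  "'a set set \<Rightarrow> 'a alloc \<Rightarrow> 'a alloc set \<Rightarrow> 'a set \<Rightarrow> 'a profile \<Rightarrow> 'a alloc set" where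
  "feasible E \<chi>\<^sub>0 \<SS> S B =
     {\<chi> \<in> \<SS>. (\<forall>a\<in>S. area_alloc E \<chi> a \<in> dom (B a)) \<and> (\<forall>e \<in> E - inner_links E S. \<chi> e = \<chi>\<^sub>0 e)}"

definition welfare :: "'a set set \<Rightarrow> 'a set \<Rightarrow> 'a profile \<Rightarrow> 'a alloc \<Rightarrow> real" where
  "welfare E S B \<chi> = (\<Sum>a\<in>S. the (B a (area_alloc E \<chi> a)))"

definition optimal ::
  "'a set set \<Rightarrow> 'a alloc \<Rightarrow> 'a alloc set \<Rightarrow> 'a set \<Rightarrow> 'a profile \<Rightarrow> 'a alloc \<Rightarrow> bool" where
  "optimal E \<chi>\<^sub>0 \<SS> S B = is_arg_max (welfare E S B) (\<lambda>\<chi>. \<chi> \<in> feasible E \<chi>\<^sub>0 \<SS> S B)"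

definition market_value ::
  "'a set set \<Rightarrow> 'a alloc \<Rightarrow> 'a alloc set \<Rightarrow> 'a set \<Rightarrow> 'a profile \<Rightarrow> real" where
  "market_value E \<chi>\<^sub>0 \<SS> S B = (GREATEST w. w \<in> welfare E S B ` feasible E \<chi>\<^sub>0 \<SS> S B)"

definition vcg_payment ::
  "'a set \<Rightarrow> 'a set set \<Rightarrow> 'a alloc \<Rightarrow> 'a alloc set \<Rightarrow> ('a profile \<Rightarrow> 'a alloc) \<Rightarrow>
   'a profile \<Rightarrow> 'a \<Rightarrow> real" where
  "vcg_payment A E \<chi>\<^sub>0 \<SS> \<chi>s B a =
     the (B a (area_alloc E (\<chi>s B) a))
       - (market_value E \<chi>\<^sub>0 \<SS> A B - market_value E \<chi>\<^sub>0 \<SS> (A - {a}) B)"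

text \<open>A nontruthful bid may lead to an allocation outside the domain of the true valuation,
  where the valuation is \<open>-\<infinity>\<close>; hence true utilities are extended reals.\<close>

definition extended_value :: "'a bid \<Rightarrow> 'a alloc \<Rightarrow> ereal" where
  "extended_value b x = (case b x of None \<Rightarrow> -\<infinity> | Some r \<Rightarrow> ereal r)"

definition utility ::
  "'a set set \<Rightarrow> 'a profile \<Rightarrow> ('a profile \<Rightarrow> 'a alloc) \<Rightarrow> ('a profile \<Rightarrow> 'a \<Rightarrow> real) \<Rightarrow>
   'a profile \<Rightarrow> 'a \<Rightarrow> ereal" where
  "utility E v \<chi>s p B a = extended_value (v a) (area_alloc E (\<chi>s B) a) - ereal (p B a)"

end

(* Under VCG payments the utility of an area is the welfare of the chosen allocation, with that
   area evaluated by its true valuation, minus a term independent of its own bid. Truthful bidding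
   makes the rule maximize exactly this welfare, so no deviation exceeds the truthful VCG utility,
   and undercharging by at most \<epsilon> raises the deviation utility by at most \<epsilon>. *)
theory Submission imports Defs begin

lemma feasible_cong:
  assumes "\<And>a. a \<in> S \<Longrightarrow> B a = B' a"
  shows "feasible E \<chi>\<^sub>0 \<SS> S B = feasible E \<chi>\<^sub>0 \<SS> S B'"
  using assms by (simp add: feasible_def)

lemma welfare_cong:
  assumes "\<And>a. a \<in> S \<Longrightarrow> B a = B' a"
  shows "welfare E S B = welfare E S B'"
  using assms by (simp add: welfare_def fun_eq_iff)

lemma market_value_cong:
  assumes "\<And>a. a \<in> S \<Longrightarrow> B a = B' a"
  shows "market_value E \<chi>\<^sub>0 \<SS> S B = market_value E \<chi>\<^sub>0 \<SS> S B'"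
  unfolding market_value_def
  using feasible_cong[of S B B', OF assms] welfare_cong[of S B B', OF assms] by simp

text \<open>\<open>GREATEST\<close> is pinned down only when the maximum is attained; an optimal
  allocation supplies the witness and the upper bound at once.\<close>

lemma market_value_optimal:
  assumes "optimal E \<chi>\<^sub>0 \<SS> S B \<chi>"
  shows "market_value E \<chi>\<^sub>0 \<SS> S B = welfare E S B \<chi>"
  unfolding market_value_def
  by (rule Greatest_equality) (use assms in \<open>auto simp: optimal_def is_arg_max_linorder\<close>)

lemma feasible_optimal:
  "optimal E \<chi>\<^sub>0 \<SS> S B \<chi> \<Longrightarrow> \<chi> \<in> feasible E \<chi>\<^sub>0 \<SS> S B"
  by (simp add: optimal_def is_arg_max_def)

lemma welfare_le_market_value:
  assumes "optimal E \<chi>\<^sub>0 \<SS> S B \<chi>" and "\<chi>' \<in> feasible E \<chi>\<^sub>0 \<SS> S B"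
  shows "welfare E S B \<chi>' \<le> market_value E \<chi>\<^sub>0 \<SS> S B"
  using assms market_value_optimal[OF assms(1)] by (simp add: optimal_def is_arg_max_linorder)

lemma welfare_fun_upd:
  assumes "finite S" and "a \<in> S"
  shows "welfare E S (B(a := b)) \<chi> = the (b (area_alloc E \<chi> a)) + welfare E (S - {a}) B \<chi>"
proof -
  have "welfare E (S - {a}) (B(a := b)) = welfare E (S - {a}) B"
    by (rule welfare_cong) simp
  then show ?thesis
    using assms by (simp add: welfare_def sum.remove fun_eq_iff)
qed

text \<open>Among the feasibility constraints only the domain condition of \<open>a\<close> involves
  the bid of \<open>a\<close>. This lets an allocation chosen under one bid compete under
  another.\<close>

lemma feasible_fun_upd:
  assumes "\<chi> \<in> feasible E \<chi>\<^sub>0 \<SS> S (B(a := b))" and "area_alloc E \<chi> a \<in> dom b'"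
  shows "\<chi> \<in> feasible E \<chi>\<^sub>0 \<SS> S (B(a := b'))"
  using assms by (auto simp: feasible_def)

text \<open>The reported value of \<open>a\<close> occurs both as the first term of the payment and
  inside the optimal welfare, and cancels. What remains is the loss that \<open>a\<close> imposes on
  the others, so \<open>b\<close> matters only through the allocation it induces.\<close>

lemma vcg_payment_fun_upd:
  assumes "finite A" and "a \<in> A" and "optimal E \<chi>\<^sub>0 \<SS> A (B(a := b)) (\<chi>s (B(a := b)))"
  shows "vcg_payment A E \<chi>\<^sub>0 \<SS> \<chi>s (B(a := b)) a
    = market_value E \<chi>\<^sub>0 \<SS> (A - {a}) B - welfare E (A - {a}) B (\<chi>s (B(a := b)))"
proof -
  have "market_value E \<chi>\<^sub>0 \<SS> (A - {a}) (B(a := b)) = market_value E \<chi>\<^sub>0 \<SS> (A - {a}) B"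
    by (rule market_value_cong) simp
  then show ?thesis
    using market_value_optimal[OF assms(3)] welfare_fun_upd[OF assms(1,2)]
    by (simp add: vcg_payment_def)
qed

lemma utility_eq:
  assumes "area_alloc E (\<chi>s B) a \<in> dom (v a)"
  shows "utility E v \<chi>s p B a = ereal (the (v a (area_alloc E (\<chi>s B) a)) - p B a)"
  using assms by (auto simp: utility_def extended_value_def)

lemma utility_outside_dom:
  assumes "area_alloc E (\<chi>s B) a \<notin> dom (v a)"
  shows "utility E v \<chi>s p B a = -\<infinity>"
  using assms by (auto simp: utility_def extended_value_def domIff)

text \<open>For a truthful bid, the true value of \<open>a\<close> plus the welfare of the others is
  the very objective that the rule has maximized.\<close>

lemma vcg_utility_truthful:
  assumes "finite A" and "a \<in> A" and opt: "optimal E \<chi>\<^sub>0 \<SS> A (B(a := v a)) (\<chi>s (B(a := v a)))"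
  shows "utility E v \<chi>s (vcg_payment A E \<chi>\<^sub>0 \<SS> \<chi>s) (B(a := v a)) a
    = ereal (market_value E \<chi>\<^sub>0 \<SS> A (B(a := v a)) - market_value E \<chi>\<^sub>0 \<SS> (A - {a}) B)"
proof -
  \<comment> \<open>Feasibility under the bid \<open>v a\<close> keeps the chosen allocation in the
    true domain, so the utility is finite.\<close>
  have "area_alloc E (\<chi>s (B(a := v a))) a \<in> dom (v a)"
    using feasible_optimal[OF opt] \<open>a \<in> A\<close> by (auto simp: feasible_def)
  then show ?thesis
    using vcg_payment_fun_upd[where \<chi>s = \<chi>s, OF assms] market_value_optimal[OF opt] welfare_fun_upd[OF assms(1,2)]
    by (simp add: utility_eq)
qed

lemma deviation_utility_le:
  assumes "finite A" and "a \<in> A"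
    and opt: "optimal E \<chi>\<^sub>0 \<SS> A (B(a := b)) (\<chi>s (B(a := b)))"
    and opt_true: "optimal E \<chi>\<^sub>0 \<SS> A (B(a := v a)) (\<chi>s (B(a := v a)))"
    and pay: "p (B(a := b)) a \<ge> vcg_payment A E \<chi>\<^sub>0 \<SS> \<chi>s (B(a := b)) a - \<epsilon>"
  shows "utility E v \<chi>s p (B(a := b)) a
    \<le> ereal \<epsilon> + utility E v \<chi>s (vcg_payment A E \<chi>\<^sub>0 \<SS> \<chi>s) (B(a := v a)) a"
proof (cases "area_alloc E (\<chi>s (B(a := b))) a \<in> dom (v a)")
  case True
  \<comment> \<open>The allocation induced by the deviation is a competitor in the truthful problem.
    Its welfare there, minus the market value without \<open>a\<close>, is the VCG utility after
    deviating; \<open>pay\<close> then costs at most \<epsilon>.\<close>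
  have "welfare E A (B(a := v a)) (\<chi>s (B(a := b))) \<le> market_value E \<chi>\<^sub>0 \<SS> A (B(a := v a))"
    using opt_true feasible_fun_upd[OF feasible_optimal[OF opt] True]
    by (rule welfare_le_market_value)
  then show ?thesis
    using pay vcg_payment_fun_upd[where \<chi>s = \<chi>s, OF assms(1,2) opt] welfare_fun_upd[OF assms(1,2)]
    by (simp add: vcg_utility_truthful[where v = v and \<chi>s = \<chi>s, OF assms(1,2) opt_true]
        utility_eq[where \<chi>s = \<chi>s and v = v, OF True])
next
  case False
  \<comment> \<open>The deviation leads outside the true domain, so its utility is minus infinity
    and the bound is trivial.\<close>
  then show ?thesis by (simp add: utility_outside_dom[where \<chi>s = \<chi>s and v = v, OF False])
qed

lemma admissible_profiles_fun_upd:
  assumes "B \<in> admissible_profiles (A - {a}) Adm" and "a \<in> A" and "b \<in> Adm a"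
  shows "B(a := b) \<in> admissible_profiles A Adm"
  using assms by (auto simp: admissible_profiles_def PiE_iff extensional_def)

theorem theorem2:
  fixes A :: "'a set" and E :: "'a set set"
    and \<chi>\<^sub>0 :: "'a alloc" and \<SS> :: "'a alloc set"
    and v :: "'a profile" and Adm :: "'a \<Rightarrow> 'a bid set"
    and \<chi>s :: "'a profile \<Rightarrow> 'a alloc"
    and p :: "'a profile \<Rightarrow> 'a \<Rightarrow> real"
    and \<epsilon> :: real
  assumes graph: "simple_graph A E" "connected_graph A E"
    and allocs: "\<SS> \<subseteq> allocations E" "\<chi>\<^sub>0 \<in> \<SS>"
    and bids: "\<And>a b. a \<in> A \<Longrightarrow> b \<in> Adm a \<Longrightarrow> valid_bid E \<chi>\<^sub>0 a b"
    and truth: "\<And>a. a \<in> A \<Longrightarrow> v a \<in> Adm a"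
    and attained: "\<And>S B. S \<subseteq> A \<Longrightarrow> B \<in> admissible_profiles A Adm \<Longrightarrow>
                     \<exists>\<chi>. optimal E \<chi>\<^sub>0 \<SS> S B \<chi>"
    and alloc_rule: "\<And>B. B \<in> admissible_profiles A Adm \<Longrightarrow> optimal E \<chi>\<^sub>0 \<SS> A B (\<chi>s B)"
    and eps: "\<epsilon> \<ge> 0"
    and payment: "\<And>a B. a \<in> A \<Longrightarrow> B \<in> admissible_profiles A Adm \<Longrightarrow>
                    p B a \<ge> vcg_payment A E \<chi>\<^sub>0 \<SS> \<chi>s B a - \<epsilon>"
  shows "\<forall>a\<in>A. \<forall>B \<in> admissible_profiles (A - {a}) Adm. \<forall>b \<in> Adm a.
     utility E v \<chi>s p (B(a := b)) a - utility E v \<chi>s p (B(a := v a)) a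
       \<le> ereal \<epsilon> + utility E v \<chi>s (vcg_payment A E \<chi>\<^sub>0 \<SS> \<chi>s) (B(a := v a)) a
          - utility E v \<chi>s p (B(a := v a)) a
     \<and> utility E v \<chi>s (vcg_payment A E \<chi>\<^sub>0 \<SS> \<chi>s) (B(a := v a)) a
       = ereal (market_value E \<chi>\<^sub>0 \<SS> A (B(a := v a)) - market_value E \<chi>\<^sub>0 \<SS> (A - {a}) B)"
proof (intro ballI conjI)
  fix a B b
  assume a: "a \<in> A" and B: "B \<in> admissible_profiles (A - {a}) Adm" and b: "b \<in> Adm a"
  have fin: "finite A"
    using graph by (simp add: simple_graph_def)
  note adm = admissible_profiles_fun_upd[OF B a]
  note opt = alloc_rule[OF adm[OF b]] and opt_true = alloc_rule[OF adm[OF truth[OF a]]]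
  show "utility E v \<chi>s (vcg_payment A E \<chi>\<^sub>0 \<SS> \<chi>s) (B(a := v a)) a
    = ereal (market_value E \<chi>\<^sub>0 \<SS> A (B(a := v a)) - market_value E \<chi>\<^sub>0 \<SS> (A - {a}) B)"
    using fin a opt_true by (rule vcg_utility_truthful)
  have "utility E v \<chi>s p (B(a := b)) a
    \<le> ereal \<epsilon> + utility E v \<chi>s (vcg_payment A E \<chi>\<^sub>0 \<SS> \<chi>s) (B(a := v a)) a"
    using fin a opt opt_true payment[OF a adm[OF b]] by (rule deviation_utility_le)
  then show "utility E v \<chi>s p (B(a := b)) a - utility E v \<chi>s p (B(a := v a)) a
       \<le> ereal \<epsilon> + utility E v \<chi>s (vcg_payment A E \<chi>\<^sub>0 \<SS> \<chi>s) (B(a := v a)) a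
          - utility E v \<chi>s p (B(a := v a)) a"
    \<comment> \<open>Both sides subtract the same truthful utility under \<open>p\<close>, and
      subtraction on \<open>ereal\<close> is monotone without a finiteness check.\<close>
    by (rule ereal_minus_mono) simp
qed

end
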